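(* Let $d\geq 3$ be an integer and let $\varepsilon>0$. There exists $C=C(d,\varepsilon)>0$ such that, for every $n$ and every graph $G$ on $[n]$ with diameter at most $d$ and maximum degree $\Delta>C$, the query complexity $q$ of $G$ satisfies $$q(d-1+\varepsilon)\Delta^{d-2}\geq\binom{n}{2}-|E(G)|.$$
   Context: $[n]:=\{1,\ldots,n\}$. For a graph $G$ on $[n]$, $d_G(x,y)$ is the graph distance between $x$ and $y$ in $G$ ($\infty$ if they lie in different components), and $E(G)$ is its edge set. A set $\mathcal{Q}\subset\binom{[n]}{2}$ of pairs of vertices reconstructs a graph $G$ on $[n]$ if for every graph $G'$ on $[n]$ such that $d_{G'}(x,y)=d_G(x,y)$ for all $\{x,y\}\in\mathcal{Q}$, we have $G'=G$. Distance query model: there is a hidden unknown graph $G$ on $[n]$, and an oracle which, for every queried pair of vertices $\{x,y\}$, answers $d_G(x,y)$. An adaptive algorithm at every step selects the next query (a pair of vertices) based on the responses of the oracle to earlier queries. A graph $G$ on $[n]$ is $q$-reconstructible by an adaptive algorithm $\mathtt{A}$ if, for the hidden input graph $G$, $\mathtt{A}$ queries at most $q$ pairs, comprising a set $\mathcal{Q}\subset\binom{[n]}{2}$ that reconstructs $G$. The (distance) query complexity of $G$ is the minimum $q$ such that $G$ is $q$-reconstructible by some adaptive algorithm (which may depend on $G$). *)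

theory Defs
  imports Complex_Main "HOL-Library.Extended_Nat"
begin

definition vertex_pairs :: "nat \<Rightarrow> nat set set" where
  "vertex_pairs n = {e. e \<subseteq> {1..n} \<and> card e = 2}"

(* A simple graph on {1..n} is identified with its edge set. *)
definition graph_on :: "nat \<Rightarrow> nat set set \<Rightarrow> bool" where
  "graph_on n E \<longleftrightarrow> E \<subseteq> vertex_pairs n"

(* The k-th relational power of adjacency relates the endpoints of walks of length k;
   the infimum of the empty set is \<infinity>, the distance between different components. *)
definition gdist :: "nat set set \<Rightarrow> nat \<Rightarrow> nat \<Rightarrow> enat" where
  "gdist E x y = Inf {enat k |k. (x, y) \<in> {(u, v). {u, v} \<in> E} ^^ k}"

definition graph_diameter :: "nat \<Rightarrow> nat set set \<Rightarrow> enat" where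
  "graph_diameter n E = (SUP x\<in>{1..n}. SUP y\<in>{1..n}. gdist E x y)"

definition vertex_degree :: "nat set set \<Rightarrow> nat \<Rightarrow> nat" where
  "vertex_degree E v = card {e \<in> E. v \<in> e}"

(* Sup on nat is the maximum of a finite nonempty set, and 0 on the empty set. *)
definition max_degree :: "nat \<Rightarrow> nat set set \<Rightarrow> nat" where
  "max_degree n E = (SUP v\<in>{1..n}. vertex_degree E v)"

definition reconstructs :: "nat \<Rightarrow> nat set set \<Rightarrow> nat set set \<Rightarrow> bool" where
  "reconstructs n Q E \<longleftrightarrow>
     Q \<subseteq> vertex_pairs n \<and>
     (\<forall>E'. graph_on n E' \<and> (\<forall>x y. {x, y} \<in> Q \<longrightarrow> gdist E' x y = gdist E x y) \<longrightarrow> E' = E)"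

(* The answer to an unordered query {x, y}; the graph distance is symmetric, so fixing the order
   of the two endpoints loses nothing. *)
definition oracle_answer :: "nat set set \<Rightarrow> nat set \<Rightarrow> enat" where
  "oracle_answer E e = gdist E (Min e) (Max e)"

(* An adaptive algorithm sees the queries made so far together with the answers, in chronological
   order, and either selects the next query or stops (None). *)
type_synonym algorithm = "(nat set \<times> enat) list \<Rightarrow> nat set option"

definition adaptive_algorithm :: "nat \<Rightarrow> algorithm \<Rightarrow> bool" where
  "adaptive_algorithm n A \<longleftrightarrow> (\<forall>h e. A h = Some e \<longrightarrow> e \<in> vertex_pairs n)"

fun transcript :: "algorithm \<Rightarrow> nat set set \<Rightarrow> nat \<Rightarrow> (nat set \<times> enat) list" where
  "transcript A E 0 = []"
| "transcript A E (Suc k) =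
     (let h = transcript A E k in
      case A h of None \<Rightarrow> h | Some e \<Rightarrow> h @ [(e, oracle_answer E e)])"

(* The algorithm stops after at most q steps, and the pairs it has queried reconstruct the graph. *)
definition reconstructible_by :: "nat \<Rightarrow> nat \<Rightarrow> algorithm \<Rightarrow> nat set set \<Rightarrow> bool" where
  "reconstructible_by n q A E \<longleftrightarrow>
     A (transcript A E q) = None \<and> reconstructs n (fst ` set (transcript A E q)) E"

definition query_complexity :: "nat \<Rightarrow> nat set set \<Rightarrow> nat" where
  "query_complexity n E = (LEAST q. \<exists>A. adaptive_algorithm n A \<and> reconstructible_by n q A E)"

lemma finite_vertex_pairs: "finite (vertex_pairs n)"
  by (rule finite_subset[of _ "Pow {1..n}"]) (auto simp: vertex_pairs_def)

lemma gdist_eq_1_iff: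
  assumes "x \<noteq> y"
  shows "gdist E x y = 1 \<longleftrightarrow> {x, y} \<in> E"
proof -
  let ?R = "{(u, v). {u, v} \<in> E}"
  let ?K = "{enat k |k. (x, y) \<in> ?R ^^ k}"
  have ge: "1 \<le> gdist E x y"
    unfolding gdist_def
  proof (rule Inf_greatest)
    fix i assume "i \<in> ?K"
    then obtain k where k: "i = enat k" "(x, y) \<in> ?R ^^ k" by blast
    with assms have "k \<noteq> 0" by (cases k) auto
    with k(1) show "1 \<le> i" by (simp add: one_enat_def)
  qed
  show ?thesis
  proof
    assume *: "gdist E x y = 1"
    then have ne: "?K \<noteq> {}" unfolding gdist_def Inf_enat_def one_enat_def
      by (metis enat.distinct(1))
    then obtain i where i: "i \<in> ?K" by blast
    have "Inf ?K \<in> ?K" unfolding Inf_enat_def if_not_P[OF ne] by (rule LeastI[of _ i]) (rule i)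
    then have "1 \<in> ?K" using * unfolding gdist_def by simp
    then obtain k where "enat k = 1" "(x, y) \<in> ?R ^^ k" by auto
    moreover from this(1) have "k = 1" by (simp add: one_enat_def)
    ultimately show "{x, y} \<in> E" by simp
  next
    assume "{x, y} \<in> E"
    then have "(x, y) \<in> ?R ^^ 1" by simp
    then have "1 \<in> ?K" unfolding one_enat_def by blast
    then have "gdist E x y \<le> 1" unfolding gdist_def by (rule Inf_lower)
    with ge show "gdist E x y = 1" by simp
  qed
qed

lemma reconstructs_all_pairs:
  assumes "graph_on n E"
  shows "reconstructs n (vertex_pairs n) E"
  unfolding reconstructs_def
proof (intro conjI allI impI)
  fix E' assume *: "graph_on n E' \<and>
    (\<forall>x y. {x, y} \<in> vertex_pairs n \<longrightarrow> gdist E' x y = gdist E x y)"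
  have "e \<in> E' \<longleftrightarrow> e \<in> E" if e: "e \<in> vertex_pairs n" for e
  proof -
    from e obtain x y where xy: "e = {x, y}" "x \<noteq> y"
      unfolding vertex_pairs_def by (auto simp: card_2_iff)
    with e * have "gdist E' x y = gdist E x y" by blast
    with xy show ?thesis by (metis gdist_eq_1_iff)
  qed
  with * assms show "E' = E" unfolding graph_on_def by blast
qed simp

(* The minimum in query_complexity is attained. *)
lemma query_complexity_attained:
  assumes "graph_on n E"
  shows "\<exists>A. adaptive_algorithm n A \<and> reconstructible_by n (query_complexity n E) A E"
proof -
  obtain L where L: "set L = vertex_pairs n"
    using finite_list[OF finite_vertex_pairs] by blast
  define A :: algorithm where
    "A h = (if length h < length L then Some (L ! length h) else None)" for h
  have "adaptive_algorithm n A"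
    unfolding adaptive_algorithm_def A_def L[symmetric]
    by (metis nth_mem option.discI option.inject)
  moreover have tr: "transcript A E k = map (\<lambda>e. (e, oracle_answer E e)) (take k L)"
    if "k \<le> length L" for k
    using that by (induction k) (auto simp: A_def take_Suc_conv_app_nth)
  have "reconstructible_by n (length L) A E"
    unfolding reconstructible_by_def using reconstructs_all_pairs[OF assms] L
    by (simp add: tr A_def image_image)
  ultimately have "\<exists>q A. adaptive_algorithm n A \<and> reconstructible_by n q A E" by blast
  then show ?thesis unfolding query_complexity_def by (rule LeastI_ex)
qed

end

theory Submission
  imports Defs
begin

text \<open>
  If a set of queries reconstructs a graph, then each non-edge must be detected: adding it to the
  graph has to change, hence to shorten, the distance of some queried pair \<open>{x, y}\<close>.  That distance
  is at most \<open>d\<close> before the addition, so the new shortest path has length at most \<open>d - 1\<close> and passes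
  through the new edge \<open>{u, v}\<close>; removing this edge leaves a walk of length \<open>i\<close> from \<open>x\<close> to \<open>u\<close> and
  one of length \<open>j\<close> from \<open>y\<close> to \<open>v\<close> with \<open>i + j \<le> d - 2\<close> (lemma \<open>shortened_distance_shortcut\<close>).

  A vertex is joined to at most \<open>\<Delta> ^ i\<close> vertices by walks of length \<open>i\<close>, so one queried pair detects
  at most \<open>\<Sum>m\<le>d-2. (m + 1) * \<Delta> ^ m\<close> non-edges (lemma \<open>card_shortcuts_le\<close>); the factor \<open>m + 1\<close>
  counts the ways to split \<open>m = i + j\<close>.  The top term is \<open>(d - 1) * \<Delta> ^ (d - 2)\<close>, and the remaining
  terms are of order \<open>\<Delta> ^ (d - 3)\<close>, so \<open>\<epsilon> * \<Delta> ^ (d - 2)\<close> absorbs them once \<open>\<Delta>\<close> is large.  An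
  algorithm that stops after \<open>q\<close> steps has queried at most \<open>q\<close> pairs, so summing over these bounds
  the number of non-edges.
\<close>

section \<open>Walks and distances\<close>

abbreviation adj :: "nat set set \<Rightarrow> (nat \<times> nat) set" where
  "adj E \<equiv> {(u, v). {u, v} \<in> E}"

lemma adj_relpow_commute: "(x, y) \<in> adj E ^^ k \<Longrightarrow> (y, x) \<in> adj E ^^ k"
proof (induction k arbitrary: y)
  case (Suc k)
  then obtain z where z: "(x, z) \<in> adj E ^^ k" "{z, y} \<in> E" by auto
  then have "(y, z) \<in> adj E" by (simp add: insert_commute)
  with Suc.IH[OF z(1)] show ?case by (meson relpow_Suc_I2)
qed simp

lemma gdist_le: "(x, y) \<in> adj E ^^ k \<Longrightarrow> gdist E x y \<le> enat k"
  unfolding gdist_def by (rule Inf_lower) blast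

lemma gdist_walk:
  assumes "gdist E x y = enat k"
  shows "(x, y) \<in> adj E ^^ k"
proof -
  let ?K = "{enat k |k. (x, y) \<in> adj E ^^ k}"
  have ne: "?K \<noteq> {}" using assms unfolding gdist_def Inf_enat_def
    by (metis (no_types, lifting) enat.distinct(1))
  then obtain i where i: "i \<in> ?K" by blast
  have "Inf ?K \<in> ?K" unfolding Inf_enat_def if_not_P[OF ne] by (rule LeastI[of _ i]) (rule i)
  with assms show ?thesis unfolding gdist_def by auto
qed

lemma gdist_antimono:
  assumes "E \<subseteq> E'"
  shows "gdist E' x y \<le> gdist E x y"
proof (cases "gdist E x y")
  case (enat k)
  have "adj E ^^ k \<subseteq> adj E' ^^ k"
  proof (induction k)
    case (Suc k)
    then show ?case using assms by (auto intro!: relcomp_mono)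
  qed simp
  with gdist_walk[OF enat] have "(x, y) \<in> adj E' ^^ k" by blast
  from gdist_le[OF this] enat show ?thesis by simp
qed simp

section \<open>Shortcuts through a new edge\<close>

text \<open>A walk may use the new edge several times.  Keeping only its part before the first use and
  its part after the last use gives one of two outcomes: if the edge is traversed in the same
  direction both times, the two parts are joined by a single traversal; otherwise they meet at a
  vertex and the edge can be avoided altogether.\<close>

lemma walk_insert_edge:
  assumes "(x, y) \<in> adj (insert e E) ^^ k"
  shows "(\<exists>l\<le>k. (x, y) \<in> adj E ^^ l) \<or>
         (\<exists>u v i j. e = {u, v} \<and> (x, u) \<in> adj E ^^ i \<and> (v, y) \<in> adj E ^^ j \<and> i + j + 1 \<le> k)"
  using assms
proof (induction k arbitrary: y)
  case 0
  then show ?case by auto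
next
  case (Suc k)
  then obtain z where z: "(x, z) \<in> adj (insert e E) ^^ k" "{z, y} \<in> insert e E" by auto
  from Suc.IH[OF z(1)] show ?case
  proof (elim disjE exE conjE)
    fix l assume l: "l \<le> k" "(x, z) \<in> adj E ^^ l"
    show ?case
    proof (cases "{z, y} \<in> E")
      case True
      with l have "(x, y) \<in> adj E ^^ Suc l" by auto
      with l(1) show ?thesis by (meson Suc_le_mono)
    next
      case False
      with z(2) have "e = {z, y}" by simp
      moreover have "(y, y) \<in> adj E ^^ 0" by simp
      moreover have "l + 0 + 1 \<le> Suc k" using l(1) by simp
      ultimately show ?thesis using l(2) by blast
    qed
  next
    fix u v i j
    assume uv: "e = {u, v}" and i: "(x, u) \<in> adj E ^^ i" and j: "(v, z) \<in> adj E ^^ j"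
      and le: "i + j + 1 \<le> k"
    show ?case
    proof (cases "{z, y} \<in> E")
      case True
      with j have "(v, y) \<in> adj E ^^ Suc j" by auto
      moreover have "i + Suc j + 1 \<le> Suc k" using le by simp
      ultimately show ?thesis using uv i by blast
    next
      case False
      with z(2) uv have "z = u \<and> y = v \<or> z = v \<and> y = u" by (auto simp: doubleton_eq_iff)
      then show ?thesis
      proof
        assume "z = u \<and> y = v"
        moreover have "(v, v) \<in> adj E ^^ 0" by simp
        moreover have "i + 0 + 1 \<le> Suc k" using le by simp
        ultimately show ?thesis using uv i by blast
      next
        assume "z = v \<and> y = u"
        moreover have "i \<le> Suc k" using le by simp
        ultimately show ?thesis using i by blast
      qed
    qed
  qed
qed

definition shortcuts :: "nat set set \<Rightarrow> nat \<Rightarrow> nat \<Rightarrow> nat \<Rightarrow> nat set set" where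
  "shortcuts E r x y =
     {{u, v} |u v i j. i + j \<le> r \<and> (x, u) \<in> adj E ^^ i \<and> (y, v) \<in> adj E ^^ j}"

lemma shortcuts_commute: "shortcuts E r x y = shortcuts E r y x"
proof -
  have "shortcuts E r a b \<subseteq> shortcuts E r b a" for a b
  proof
    fix e assume "e \<in> shortcuts E r a b"
    then obtain u v i j where "e = {v, u}" "j + i \<le> r" "(a, u) \<in> adj E ^^ i" "(b, v) \<in> adj E ^^ j"
      unfolding shortcuts_def by (auto simp: insert_commute add.commute)
    then show "e \<in> shortcuts E r b a" unfolding shortcuts_def by blast
  qed
  then show ?thesis by blast
qed

lemma shortened_distance_shortcut:
  assumes "gdist E x y \<le> enat d" and "gdist (insert e E) x y \<noteq> gdist E x y"
  shows "e \<in> shortcuts E (d - 2) x y"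
proof -
  have "gdist (insert e E) x y < gdist E x y"
    using gdist_antimono[OF subset_insertI] assms(2) by (rule le_neq_trans)
  then obtain k where k: "gdist (insert e E) x y = enat k" and lt: "enat k < gdist E x y"
    by (cases "gdist (insert e E) x y") auto
  have "\<not> (\<exists>l\<le>k. (x, y) \<in> adj E ^^ l)"
    using lt gdist_le by (meson enat_ord_simps(1) leD order_trans)
  with walk_insert_edge[OF gdist_walk[OF k]] obtain u v i j where
    *: "e = {u, v}" "(x, u) \<in> adj E ^^ i" "(v, y) \<in> adj E ^^ j" "i + j + 1 \<le> k" by blast
  from lt assms(1) have "k < d" by (metis enat_ord_simps(2) order_less_le_trans)
  with *(4) have "i + j \<le> d - 2" by simp
  with * adj_relpow_commute[OF *(3)] show ?thesis unfolding shortcuts_def by blast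
qed

section \<open>Counting the shortcuts of one query\<close>

lemma card_neighbours_le_max_degree:
  assumes "graph_on n E"
  shows "finite {u. {v, u} \<in> E}" and "card {u. {v, u} \<in> E} \<le> max_degree n E"
proof -
  have fin: "finite E" using assms finite_vertex_pairs finite_subset unfolding graph_on_def by blast
  have inj: "inj_on (\<lambda>u. {v, u}) {u. {v, u} \<in> E}" by (auto simp: inj_on_def doubleton_eq_iff)
  have sub: "(\<lambda>u. {v, u}) ` {u. {v, u} \<in> E} \<subseteq> {e \<in> E. v \<in> e}" by auto
  show "finite {u. {v, u} \<in> E}"
    using fin by (intro finite_imageD[OF finite_subset[OF sub] inj]) simp
  have le: "card {u. {v, u} \<in> E} \<le> vertex_degree E v"
    unfolding vertex_degree_def using inj sub fin by (intro card_inj_on_le) auto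
  show "card {u. {v, u} \<in> E} \<le> max_degree n E"
  proof (cases "v \<in> {1..n}")
    case True
    then have "vertex_degree E v \<le> max_degree n E"
      unfolding max_degree_def by (intro cSUP_upper) auto
    with le show ?thesis by simp
  next
    case False
    with assms have "{u. {v, u} \<in> E} = {}" unfolding graph_on_def vertex_pairs_def by auto
    then show ?thesis by simp
  qed
qed

lemma card_walk_ends_le:
  assumes "graph_on n E"
  shows "finite {u. (x, u) \<in> adj E ^^ i} \<and> card {u. (x, u) \<in> adj E ^^ i} \<le> max_degree n E ^ i"
proof (induction i)
  case (Suc i)
  let ?W = "{u. (x, u) \<in> adj E ^^ i}"
  have eq: "{u. (x, u) \<in> adj E ^^ Suc i} = (\<Union>v\<in>?W. {u. {v, u} \<in> E})" by auto
  have "card (\<Union>v\<in>?W. {u. {v, u} \<in> E}) \<le> (\<Sum>v\<in>?W. card {u. {v, u} \<in> E})"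
    using Suc.IH by (intro card_UN_le) auto
  also have "\<dots> \<le> card ?W * max_degree n E"
    using sum_bounded_above[of ?W "\<lambda>v. card {u. {v, u} \<in> E}" "max_degree n E"]
      card_neighbours_le_max_degree(2)[OF assms] by simp
  also have "\<dots> \<le> max_degree n E ^ i * max_degree n E" using Suc.IH by (intro mult_right_mono) auto
  finally show ?case
    unfolding eq using Suc.IH card_neighbours_le_max_degree(1)[OF assms] by (simp add: mult.commute)
qed simp

lemma card_shortcuts_le:
  assumes "graph_on n E"
  shows "finite (shortcuts E r x y) \<and>
    card (shortcuts E r x y) \<le> (\<Sum>m\<le>r. (m + 1) * max_degree n E ^ m)"
proof -
  let ?W = "\<lambda>x i. {u. (x, u) \<in> adj E ^^ i}" and ?D = "max_degree n E"
  let ?P = "\<lambda>m. \<Union>i\<le>m. ?W x i \<times> ?W y (m - i)"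
  have fin: "finite (?P m)" for m using card_walk_ends_le[OF assms] by auto
  have "card (?P m) \<le> (m + 1) * ?D ^ m" for m
  proof -
    have "card (?P m) \<le> (\<Sum>i\<le>m. card (?W x i \<times> ?W y (m - i)))" by (intro card_UN_le) auto
    also have "\<dots> \<le> (\<Sum>i\<le>m. ?D ^ m)"
    proof (intro sum_mono)
      fix i assume "i \<in> {..m}"
      then have "?D ^ m = ?D ^ i * ?D ^ (m - i)" by (simp flip: power_add)
      then show "card (?W x i \<times> ?W y (m - i)) \<le> ?D ^ m"
        unfolding card_cartesian_product using card_walk_ends_le[OF assms] by (simp add: mult_mono)
    qed
    finally show ?thesis by simp
  qed
  then have "(\<Sum>m\<le>r. card (?P m)) \<le> (\<Sum>m\<le>r. (m + 1) * ?D ^ m)" by (rule sum_mono)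
  then have "card (\<Union>m\<le>r. ?P m) \<le> (\<Sum>m\<le>r. (m + 1) * ?D ^ m)"
    by (rule order_trans[OF card_UN_le[OF finite_atMost]])
  moreover have sub: "shortcuts E r x y \<subseteq> (\<lambda>(u, v). {u, v}) ` (\<Union>m\<le>r. ?P m)"
  proof
    fix e assume "e \<in> shortcuts E r x y"
    then obtain u v i j where *: "e = {u, v}" "i + j \<le> r" "(x, u) \<in> adj E ^^ i"
      "(y, v) \<in> adj E ^^ j" unfolding shortcuts_def by blast
    then have "(u, v) \<in> ?P (i + j)" by (intro UN_I[of i]) auto
    with *(2) have "(u, v) \<in> (\<Union>m\<le>r. ?P m)" by blast
    with *(1) show "e \<in> (\<lambda>(u, v). {u, v}) ` (\<Union>m\<le>r. ?P m)"
      by (intro image_eqI[of _ _ "(u, v)"]) auto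
  qed
  moreover have finP: "finite (\<Union>m\<le>r. ?P m)" using fin by blast
  moreover have "card (shortcuts E r x y) \<le> card (\<Union>m\<le>r. ?P m)"
    by (rule surj_card_le[OF finP sub])
  ultimately show ?thesis by (meson finite_imageI finite_subset order_trans)
qed

section \<open>Counting the non-edges\<close>

lemma reconstructs_imp_nonedge_shortcut:
  assumes "graph_on n E" "graph_diameter n E \<le> enat d" "reconstructs n Q E"
    and "e \<in> vertex_pairs n - E"
  shows "\<exists>x y. {x, y} \<in> Q \<and> e \<in> shortcuts E (d - 2) x y"
proof -
  have "graph_on n (insert e E)" "insert e E \<noteq> E" using assms(1,4) unfolding graph_on_def by auto
  with assms(3) obtain x y where xy: "{x, y} \<in> Q" "gdist (insert e E) x y \<noteq> gdist E x y"
    unfolding reconstructs_def by blast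
  have "{x, y} \<in> vertex_pairs n" using xy(1) assms(3) unfolding reconstructs_def by blast
  then have "x \<in> {1..n}" "y \<in> {1..n}" unfolding vertex_pairs_def by auto
  then have "gdist E x y \<le> graph_diameter n E"
    unfolding graph_diameter_def by (meson SUP_upper SUP_upper2)
  with assms(2) have "gdist E x y \<le> enat d" by (rule order_trans[rotated])
  from shortened_distance_shortcut[OF this xy(2)] xy(1) show ?thesis by blast
qed

lemma card_nonedges_le:
  assumes "graph_on n E" "graph_diameter n E \<le> enat d" "reconstructs n Q E"
  shows "card (vertex_pairs n - E) \<le> card Q * (\<Sum>m\<le>d - 2. (m + 1) * max_degree n E ^ m)"
proof -
  let ?B = "\<Sum>m\<le>d - 2. (m + 1) * max_degree n E ^ m"
  \<comment> \<open>The set of shortcuts is symmetric in the endpoints of the query, so ordering them is harmless.\<close>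
  let ?S = "\<lambda>q. shortcuts E (d - 2) (Min q) (Max q)"
  have Q: "finite Q"
    using assms(3) finite_vertex_pairs finite_subset unfolding reconstructs_def by blast
  have "vertex_pairs n - E \<subseteq> (\<Union>q\<in>Q. ?S q)"
  proof
    fix e assume "e \<in> vertex_pairs n - E"
    from reconstructs_imp_nonedge_shortcut[OF assms this] obtain x y where
      xy: "{x, y} \<in> Q" "e \<in> shortcuts E (d - 2) x y" by blast
    have "?S {x, y} = shortcuts E (d - 2) x y"
      using shortcuts_commute by (cases "x \<le> y") (auto simp: min_def max_def)
    with xy show "e \<in> (\<Union>q\<in>Q. ?S q)" by blast
  qed
  then have "card (vertex_pairs n - E) \<le> card (\<Union>q\<in>Q. ?S q)"
    using Q card_shortcuts_le[OF assms(1)] by (intro card_mono) auto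
  also have "\<dots> \<le> (\<Sum>q\<in>Q. card (?S q))" by (rule card_UN_le[OF Q])
  also have "\<dots> \<le> card Q * ?B"
    using sum_bounded_above[of Q "\<lambda>q. card (?S q)" ?B] card_shortcuts_le[OF assms(1)] by simp
  finally show ?thesis .
qed

lemma length_transcript_le: "length (transcript A E k) \<le> k"
  by (induction k) (auto simp: Let_def split: option.split)

lemma exists_reconstructing_set:
  assumes "graph_on n E"
  obtains Q where "reconstructs n Q E" "card Q \<le> query_complexity n E"
proof -
  let ?q = "query_complexity n E"
  obtain A where A: "reconstructible_by n ?q A E" using query_complexity_attained[OF assms] by blast
  let ?Q = "fst ` set (transcript A E ?q)"
  have "card ?Q \<le> ?q"
    by (meson List.finite_set card_image_le card_length length_transcript_le order_trans)
  with A that show thesis unfolding reconstructible_by_def by blast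
qed

text \<open>All terms below the top one are at most \<open>r * D ^ (r - 1)\<close>, and there are \<open>r\<close> of them, which
  is where the threshold \<open>r\<^sup>2 / \<epsilon>\<close> comes from.\<close>

lemma sum_Suc_power_le:
  fixes D \<epsilon> :: real
  assumes "r \<ge> 1" "\<epsilon> > 0" "D \<ge> 1" "D \<ge> real r ^ 2 / \<epsilon>"
  shows "(\<Sum>m\<le>r. (real m + 1) * D ^ m) \<le> (real r + 1 + \<epsilon>) * D ^ r"
proof -
  have "(\<Sum>m<r. (real m + 1) * D ^ m) \<le> (\<Sum>m<r. real r * D ^ (r - 1))"
    using assms(3) by (intro sum_mono mult_mono power_increasing) auto
  also have "\<dots> = real r ^ 2 * D ^ (r - 1)" by (simp add: power2_eq_square)
  also have "\<dots> \<le> (\<epsilon> * D) * D ^ (r - 1)"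
    using assms by (intro mult_right_mono) (auto simp: divide_le_eq mult.commute)
  also have "\<dots> = \<epsilon> * D ^ r" using assms(1) by (cases r) auto
  finally show ?thesis by (simp add: lessThan_Suc_atMost[symmetric] algebra_simps)
qed

theorem claim5p1:
  fixes d :: nat and \<epsilon> :: real
  assumes "d \<ge> 3" and "\<epsilon> > 0"
  shows "\<exists>C::real. C > 0 \<and>
    (\<forall>(n::nat) (E::nat set set).
       graph_on n E \<longrightarrow> graph_diameter n E \<le> enat d \<longrightarrow> real (max_degree n E) > C \<longrightarrow>
       real (query_complexity n E) * (real d - 1 + \<epsilon>) * real (max_degree n E) ^ (d - 2)
         \<ge> real (n choose 2) - real (card E))"
proof (intro exI[of _ "max 1 (real (d - 2) ^ 2 / \<epsilon>)"] conjI allI impI)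
  fix n E
  assume E: "graph_on n E" and diam: "graph_diameter n E \<le> enat d"
    and deg: "max 1 (real (d - 2) ^ 2 / \<epsilon>) < real (max_degree n E)"
  let ?D = "max_degree n E" and ?q = "query_complexity n E"
  let ?B = "\<Sum>m\<le>d - 2. (m + 1) * ?D ^ m"
  obtain Q where Q: "reconstructs n Q E" "card Q \<le> ?q" by (rule exists_reconstructing_set[OF E])
  have "real (n choose 2) - real (card E) = real (card (vertex_pairs n - E))"
  proof -
    have sub: "E \<subseteq> vertex_pairs n" using E unfolding graph_on_def .
    have "card (vertex_pairs n) = n choose 2"
      using n_subsets[of "{1..n}" 2] unfolding vertex_pairs_def by simp
    with sub show ?thesis
      using card_Diff_subset[OF finite_subset[OF sub finite_vertex_pairs] sub]
        card_mono[OF finite_vertex_pairs sub] by simp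
  qed
  also have "\<dots> \<le> real (?q * ?B)"
    using card_nonedges_le[OF E diam Q(1)] Q(2) by (meson mult_le_mono1 of_nat_mono order_trans)
  also have "\<dots> = real ?q * (\<Sum>m\<le>d - 2. (real m + 1) * real ?D ^ m)" by (simp add: algebra_simps)
  also have "\<dots> \<le> real ?q * ((real (d - 2) + 1 + \<epsilon>) * real ?D ^ (d - 2))"
    using assms deg by (intro mult_left_mono sum_Suc_power_le) auto
  also have "real (d - 2) + 1 = real d - 1" using assms(1) by simp
  finally show "real ?q * (real d - 1 + \<epsilon>) * real ?D ^ (d - 2) \<ge> real (n choose 2) - real (card E)"
    by (simp add: mult.assoc)
qed simp

end
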